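(* There is a locally countable, locally compact, $0$-dimensional $T_2$ space $X$ such that $X$ is not linearly D, but $X$ satisfies the following property $( ** )$: for every regular uncountable cardinal $\kappa$ and every $A\subseteq X$ with $|A|=\kappa$, either $A$ has a complete accumulation point in $X$, or there is $D\subseteq\overline{A}$ with $|D|=\kappa$ which is closed discrete in $X$.
   Context: A space is locally countable if every point has a countable neighborhood; it is $0$-dimensional if it has a base of clopen sets. A subset of a space is closed discrete if it is closed and discrete in the subspace topology. A point $x\in X$ is a complete (full) accumulation point of $A$ if $|U\cap A|=|A|$ for every neighborhood $U$ of $x$. An open neighborhood assignment (ONA) on $(X,\tau)$ is a map $U:X\to\tau$ with $x\in U(x)$ for all $x\in X$. $X$ is linearly D if for every ONA $U$ for which $\{U(x):x\in X\}$ is linearly ordered by inclusion there is a closed discrete $D\subseteq X$ with $X=\bigcup_{d\in D}U(d)$. *)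

theory Defs
  imports "HOL-Analysis.Analysis"
begin

unbundle cardinal_syntax

definition nbhd_in :: "'a topology \<Rightarrow> 'a \<Rightarrow> 'a set \<Rightarrow> bool"
  where "nbhd_in X x N \<longleftrightarrow>
    N \<subseteq> topspace X \<and> (\<exists>U. openin X U \<and> x \<in> U \<and> U \<subseteq> N)"

definition locally_countable_space :: "'a topology \<Rightarrow> bool"
  where "locally_countable_space X \<longleftrightarrow>
    (\<forall>x \<in> topspace X. \<exists>N. nbhd_in X x N \<and> countable N)"

(* The second conjunct is the library's way (arbitrary union_of) of saying that B is a base of X. *)
definition zero_dimensional_space :: "'a topology \<Rightarrow> bool"
  where "zero_dimensional_space X \<longleftrightarrow>
    (\<exists>B. (\<forall>U \<in> B. openin X U \<and> closedin X U) \<and>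
         openin X = arbitrary union_of (\<lambda>U. U \<in> B))"

definition closed_discrete_in :: "'a topology \<Rightarrow> 'a set \<Rightarrow> bool"
  where "closed_discrete_in X D \<longleftrightarrow>
    closedin X D \<and> subtopology X D = discrete_topology D"

definition complete_accumulation_point :: "'a topology \<Rightarrow> 'a set \<Rightarrow> 'a \<Rightarrow> bool"
  where "complete_accumulation_point X A x \<longleftrightarrow>
    x \<in> topspace X \<and> (\<forall>N. nbhd_in X x N \<longrightarrow> |N \<inter> A| =o |A| )"

definition open_nbhd_assignment :: "'a topology \<Rightarrow> ('a \<Rightarrow> 'a set) \<Rightarrow> bool"
  where "open_nbhd_assignment X U \<longleftrightarrow>
    (\<forall>x \<in> topspace X. openin X (U x) \<and> x \<in> U x)"

definition linearly_D_space :: "'a topology \<Rightarrow> bool"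
  where "linearly_D_space X \<longleftrightarrow>
    (\<forall>U. open_nbhd_assignment X U \<and> chain\<^sub>\<subseteq> (U ` topspace X) \<longrightarrow>
      (\<exists>D. closed_discrete_in X D \<and> topspace X = (\<Union>d\<in>D. U d)))"

(* Cardinals kappa live on the type of the points; this loses nothing, since
   only cardinals of subsets A of the space matter. *)
definition complete_accumulation_or_closed_discrete :: "'a topology \<Rightarrow> bool"
  where "complete_accumulation_or_closed_discrete X \<longleftrightarrow>
    (\<forall>(\<kappa> :: 'a rel) A.
      Card_order \<kappa> \<and> regularCard \<kappa> \<and> uncountable (Field \<kappa>) \<and>
      A \<subseteq> topspace X \<and> |A| =o \<kappa> \<longrightarrow>
        (\<exists>x. complete_accumulation_point X A x) \<or>
        (\<exists>D. D \<subseteq> X closure_of A \<and> |D| =o \<kappa> \<and> closed_discrete_in X D))"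

end

(*
  Idea.  Refine the topology of the real line.  Distribute the reals over levels indexed by omega_1
  and let a point x be a limit only of points of strictly smaller level.  If the levels of a
  countable set S are pairwise distinct and below lev x, and x lies in the Euclidean closure of S,
  then x may be turned into a limit of S: take a sequence in S tending to x together with compact
  open countable neighbourhoods of its members, shrinking so fast that the resulting
  neighbourhoods of x still meet every level in a finite set.  Hence every level is closed discrete.

  An uncountable closed set of reals has the size of the continuum, so the bookkeeping can be
  arranged such that every such S with uncountable Euclidean closure acquires uncountably many
  limits on each level above it.  A set A meeting uncountably many levels contains such an S, so
  its closure contains an uncountable part of a single level.  It follows that closed discrete sets
  are bounded in level, and the sets {y. lev y <= lev x} refute linear D-ness.  For (**), a set of
  regular uncountable size kappa either has kappa points on one level, or has size omega_1 and
  meets omega_1 levels; in both cases the closure contains kappa points of a single level.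
*)
theory Submission
  imports Defs "HOL-Library.Countable_Set_Type"
begin

section \<open>The ordinal omega-1\<close>

text \<open>The successor cardinal of aleph_0 is itself a well-order. Its field, made into a type,
  can join the class \<open>wellorder\<close>, so that levels support induction and
  recursion.\<close>

typedef omega1 = "Field (cardSuc natLeq)"
  using Field_cardSuc_not_empty[OF natLeq_Card_order] by blast

lemma omega1_order:
  "refl_on (Field (cardSuc natLeq)) (cardSuc natLeq)" "trans (cardSuc natLeq)"
  "antisym (cardSuc natLeq)" "total_on (Field (cardSuc natLeq)) (cardSuc natLeq)"
  "wf (cardSuc natLeq - Id)"
  using cardSuc_Well_order[OF natLeq_Card_order]
  unfolding well_order_on_def linear_order_on_def partial_order_on_def preorder_on_def by auto

instantiation omega1 :: linorder
begin

definition less_eq_omega1 :: "omega1 \<Rightarrow> omega1 \<Rightarrow> bool"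
  where "a \<le> b \<longleftrightarrow> (Rep_omega1 a, Rep_omega1 b) \<in> cardSuc natLeq"

definition less_omega1 :: "omega1 \<Rightarrow> omega1 \<Rightarrow> bool"
  where "(a :: omega1) < b \<longleftrightarrow> a \<le> b \<and> a \<noteq> b"

instance
proof
  fix a b c :: omega1
  show "a \<le> a"
    using omega1_order(1) by (simp add: Rep_omega1 less_eq_omega1_def refl_onD)
  show "a \<le> c" if "a \<le> b" "b \<le> c"
    using that omega1_order(2) by (metis less_eq_omega1_def transD)
  show anti: "a = b" if "a \<le> b" "b \<le> a"
    using that omega1_order(3) by (metis Rep_omega1_inject antisymD less_eq_omega1_def)
  show "a < b \<longleftrightarrow> a \<le> b \<and> \<not> b \<le> a"
    using anti \<open>a \<le> a\<close> by (auto simp: less_omega1_def)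
  show "a \<le> b \<or> b \<le> a"
    using omega1_order(4) \<open>a \<le> a\<close> Rep_omega1
    by (metis less_eq_omega1_def total_on_def)
qed

end

instance omega1 :: wellorder
proof (rule wf_wellorderI)
  have "{(a :: omega1, b). a < b} \<subseteq> inv_image (cardSuc natLeq - Id) Rep_omega1"
    by (auto simp: less_omega1_def less_eq_omega1_def Rep_omega1_inject)
  then show "wf {(a :: omega1, b). a < b}"
    using omega1_order(5) wf_inv_image wf_subset by blast
qed intro_classes

lemma card_of_omega1: "|UNIV :: omega1 set| =o cardSuc natLeq"
proof -
  have "bij_betw Rep_omega1 UNIV (Field (cardSuc natLeq))"
    by (simp add: bij_betw_def inj_on_def Rep_omega1_inject type_definition.Rep_range[OF type_definition_omega1])
  then have "|UNIV :: omega1 set| =o |Field (cardSuc natLeq)|"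
    using card_of_ordIso by blast
  also have "|Field (cardSuc natLeq)| =o cardSuc natLeq"
    using card_of_Field_ordIso cardSuc_Card_order natLeq_Card_order by blast
  finally show ?thesis .
qed

text \<open>No cardinal lies strictly between aleph_0 and its successor. Uncountability thus becomes
  a cardinal inequality that can be chained with others.\<close>

lemma uncountable_iff_omega1_le: "uncountable A \<longleftrightarrow> |UNIV :: omega1 set| \<le>o |A|"
proof -
  have "uncountable A \<longleftrightarrow> natLeq <o |A|"
    unfolding countable_card_le_natLeq
    by (rule not_ordLeq_iff_ordLess[OF natLeq_Well_order card_of_Well_order])
  also have "\<dots> \<longleftrightarrow> cardSuc natLeq \<le>o |A|"
    by (rule cardSuc_ordLess_ordLeq[OF natLeq_Card_order card_of_Card_order])
  also have "\<dots> \<longleftrightarrow> |UNIV :: omega1 set| \<le>o |A|"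
    using ordIso_ordLeq_trans[OF card_of_omega1] ordIso_ordLeq_trans[OF ordIso_symmetric[OF card_of_omega1]]
    by (intro iffI)
  finally show ?thesis .
qed

lemma countable_atMost_omega1: "countable {..b :: omega1}"
proof -
  let ?r = "cardSuc natLeq"
  have "Rep_omega1 ` {..<b} \<subseteq> underS ?r (Rep_omega1 b)"
    by (auto simp: underS_def less_omega1_def less_eq_omega1_def Rep_omega1_inject)
  moreover have "|underS ?r (Rep_omega1 b)| <o ?r"
    by (intro card_of_underS cardSuc_Card_order natLeq_Card_order Rep_omega1)
  ultimately have "|Rep_omega1 ` {..<b}| <o ?r"
    using card_of_mono1 ordLeq_ordLess_trans by blast
  then have "countable (Rep_omega1 ` {..<b})"
    unfolding countable_card_le_natLeq
    using cardSuc_ordLeq_ordLess[OF natLeq_Card_order card_of_Card_order] by blast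
  then have "countable {..<b}"
    by (rule countable_image_inj_on) (simp add: inj_on_def Rep_omega1_inject)
  moreover have "{..b} = insert b {..<b}"
    by auto
  ultimately show ?thesis
    by simp
qed

text \<open>Regularity of omega_1: countably many countable initial segments cannot exhaust an
  uncountable type.\<close>

lemma countable_omega1_bounded:
  fixes B :: "omega1 set"
  assumes "countable B"
  obtains b where "\<forall>a\<in>B. a < b"
proof -
  have "countable (\<Union>a\<in>B. {..a})"
    using assms countable_atMost_omega1 by blast
  moreover have "uncountable (UNIV :: omega1 set)"
    unfolding uncountable_iff_omega1_le by (rule card_of_mono1) simp
  ultimately have "(\<Union>a\<in>B. {..a}) \<noteq> UNIV"
    by auto
  then obtain b where "b \<notin> (\<Union>a\<in>B. {..a})"
    by blast
  then have "\<forall>a\<in>B. a < b"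
    by (simp add: not_le)
  then show ?thesis
    by (rule that)
qed

section \<open>Sets of size continuum\<close>

text \<open>Transfinite recursion along a well-order of \<open>I\<close> in which every proper initial segment
  is smaller than each \<open>F i\<close>.\<close>
lemma inj_choice_of_large_sets:
  assumes "\<And>i. i \<in> I \<Longrightarrow> |I| \<le>o |F i|"
  obtains f where "inj_on f I" "\<And>i. i \<in> I \<Longrightarrow> f i \<in> F i"
proof -
  define r where "r = |I|"
  have r: "Card_order r" "Field r = I"
    by (simp_all add: r_def card_of_card_order_on Field_card_of)
  then have wo: "wf (r - Id)" "total_on I r"
    by (auto simp: card_order_on_def well_order_on_def linear_order_on_def)
  define f where "f = wfrec (r - Id) (\<lambda>f i. SOME y. y \<in> F i - f ` underS r i)"
  have f: "f i \<in> F i - f ` underS r i" if "i \<in> I" for i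
  proof -
    have "|underS r i| <o |I|"
      using card_of_underS[OF r(1)] r(2) that by (simp add: r_def)
    then have "|f ` underS r i| <o |F i|"
      using assms[OF that] card_of_image ordLeq_ordLess_trans ordLess_ordLeq_trans by blast
    then have "\<not> F i \<subseteq> f ` underS r i"
      using card_of_mono1 not_ordLess_ordLeq by blast
    then have "\<exists>y. y \<in> F i - f ` underS r i"
      by blast
    then have "(SOME y. y \<in> F i - f ` underS r i) \<in> F i - f ` underS r i"
      by (rule someI_ex)
    moreover have "cut f (r - Id) i ` underS r i = f ` underS r i"
      by (intro image_cong) (auto simp: underS_def cut_apply)
    then have "f i = (SOME y. y \<in> F i - f ` underS r i)"
      using def_wfrec[OF f_def[THEN eq_reflection] wo(1), of i] by simp
    ultimately show ?thesis
      by simp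
  qed
  have "inj_on f I"
  proof (rule inj_onI)
    fix i j assume ij: "i \<in> I" "j \<in> I" "f i = f j"
    show "i = j"
    proof (rule ccontr)
      assume "i \<noteq> j"
      then have "i \<in> underS r j \<or> j \<in> underS r i"
        using wo(2) ij by (auto simp: underS_def total_on_def)
      then show False
        using f[OF ij(1)] f[OF ij(2)] ij(3) by (metis DiffD2 imageI)
    qed
  qed
  moreover have "f i \<in> F i" if "i \<in> I" for i
    using f[OF that] by simp
  ultimately show ?thesis
    by (rule that)
qed

text \<open>Cantor-Bendixson: deleting from \<open>C\<close> all basic open sets that meet it in a
  countable set removes only countably many points and leaves a nonempty perfect set, into which the
  reals embed.\<close>

lemma uncountable_closed_lepoll:
  fixes C :: "'a::euclidean_space set"
  assumes "closed C" "uncountable C"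
  shows "(UNIV :: real set) \<lesssim> C"
proof -
  obtain \<B> :: "'a set set" where \<B>: "countable \<B>" "topological_basis \<B>"
    using ex_countable_basis by blast
  define Z where "Z = \<Union>{B \<in> \<B>. countable (B \<inter> C)}"
  have Z: "countable (Z \<inter> C)"
  proof -
    have "Z \<inter> C = (\<Union>B\<in>{B \<in> \<B>. countable (B \<inter> C)}. B \<inter> C)"
      by (auto simp: Z_def)
    also have "countable \<dots>"
      using \<B>(1) by (intro countable_UN) auto
    finally show ?thesis .
  qed
  have nbhd: "uncountable (G \<inter> C)" if G: "open G" "x \<in> G" "x \<notin> Z" for G x
  proof -
    obtain B where "B \<in> \<B>" "x \<in> B" "B \<subseteq> G"
      using topological_basisE[OF \<B>(2) G(1,2)] by metis
    then have "uncountable (B \<inter> C)"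
      using G(3) by (auto simp: Z_def)
    then show ?thesis
      using \<open>B \<subseteq> G\<close> by (meson Int_mono countable_subset order_refl)
  qed
  have limpt: "x islimpt (C - Z)" if "x \<notin> Z" for x
  proof (rule islimptI)
    fix G assume "x \<in> G" "open G"
    then have "uncountable (G \<inter> C)"
      using nbhd that by blast
    then have "uncountable (G \<inter> C - (insert x (Z \<inter> C)))"
      using Z by (meson countable_insert uncountable_minus_countable)
    then obtain y where "y \<in> G \<inter> C - (insert x (Z \<inter> C))"
      by (metis countable_empty equals0I)
    then show "\<exists>y\<in>C - Z. y \<in> G \<and> y \<noteq> x"
      by blast
  qed
  have "open Z"
    using \<B>(2) by (auto simp: Z_def intro!: open_Union dest: topological_basis_open)
  then have "closed (C - Z)"
    using assms(1) by auto
  have "euclidean derived_set_of (C - Z) = {x. x islimpt (C - Z)}"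
    unfolding derived_set_of_def islimpt_def topspace_euclidean open_openin[symmetric] by fast
  also have "\<dots> = C - Z"
    using limpt \<open>closed (C - Z)\<close> unfolding closed_limpt by blast
  finally have "euclidean derived_set_of (C - Z) = C - Z" .
  moreover have "C - Z \<noteq> {}"
    using Z assms(2) by (metis Diff_eq_empty_iff inf.absorb_iff2)
  ultimately have "(UNIV :: real set) \<lesssim> C - Z"
    by (intro lepoll_perfect_set[where X = euclidean]) (auto simp: completely_metrizable_space_euclidean)
  then show ?thesis
    by (meson Diff_subset lepoll_trans subset_imp_lepoll)
qed

lemma lepoll_iff_card_of: "A \<lesssim> B \<longleftrightarrow> |A| \<le>o |B|"
  by (simp add: lepoll_def card_of_ordLeq)

text \<open>\<open>C - S\<close> is still infinite, so putting the countable set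
  \<open>C \<inter> S\<close> back does not raise its cardinality.\<close>

lemma lepoll_Diff_countable:
  assumes "A \<lesssim> C" "uncountable A" "countable S"
  shows "A \<lesssim> C - S"
proof -
  have "uncountable C"
    using assms(1,2) by (metis countable_lepoll)
  then have unc: "uncountable (C - S)"
    using assms(3) by (simp add: uncountable_minus_countable)
  have "|C \<inter> S| \<le>o natLeq"
    using assms(3) countable_card_le_natLeq by (metis countable_Int2)
  moreover have "natLeq \<le>o |C - S|"
    using unc countable_finite infinite_iff_natLeq_ordLeq by blast
  ultimately have "|(C - S) \<union> (C \<inter> S)| \<le>o |C - S|"
    using unc countable_finite ordLeq_transitive
    by (intro card_of_Un_ordLeq_infinite_Field card_of_Card_order) (auto simp: Field_card_of card_of_mono1)
  then have "|C| \<le>o |C - S|"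
    by (simp add: Un_Diff_Int)
  with assms(1) show ?thesis
    unfolding lepoll_iff_card_of using ordLeq_transitive by blast
qed

text \<open>Elements of \<open>omega1\<close> are represented by sets of naturals, since \<open>cardSuc natLeq\<close> is an
  order on \<open>nat set\<close>; so everything is coded by a sequence of sets of naturals.\<close>
lemma card_of_sequences_levels:
  "|UNIV :: ((nat \<Rightarrow> real) \<times> omega1 \<times> omega1) set| \<le>o |UNIV :: real set|"
proof -
  obtain g :: "real \<Rightarrow> nat set" where "inj g"
    using nat_sets_eqpoll_reals by (meson eqpoll_def eqpoll_sym bij_betw_def)
  define q :: "(nat \<Rightarrow> real) \<times> omega1 \<times> omega1 \<Rightarrow> nat \<Rightarrow> nat set"
    where "q = (\<lambda>(\<sigma>, \<beta>, \<eta>). case_nat (Rep_omega1 \<beta>) (case_nat (Rep_omega1 \<eta>) (\<lambda>n. g (\<sigma> n))))"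
  have "inj q"
  proof (rule injI)
    fix i i' assume "q i = q i'"
    moreover obtain \<sigma> \<beta> \<eta> \<sigma>' \<beta>' \<eta>' where i: "i = (\<sigma>, \<beta>, \<eta>)" "i' = (\<sigma>', \<beta>', \<eta>')"
      using prod_cases3 by metis
    ultimately have eq: "q (\<sigma>, \<beta>, \<eta>) n = q (\<sigma>', \<beta>', \<eta>') n" for n
      by simp
    have "\<sigma> = \<sigma>'"
      using eq[of "Suc (Suc _)"] \<open>inj g\<close> by (auto simp: q_def inj_eq)
    then show "i = i'"
      unfolding i using eq[of 0] eq[of 1] by (simp add: q_def Rep_omega1_inject)
  qed
  \<comment> \<open>With pairs coded as naturals, the graph of a sequence of sets of naturals is a
    single set of naturals.\<close>
  moreover have "inj (\<lambda>p. prod_encode ` Sigma (UNIV :: nat set) p)"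
  proof (rule injI)
    fix p p' :: "nat \<Rightarrow> nat set"
    assume "prod_encode ` Sigma UNIV p = prod_encode ` Sigma UNIV p'"
    then have "Sigma UNIV p = Sigma UNIV p'"
      by (simp add: inj_image_eq_iff inj_prod_encode)
    then show "p = p'"
      by (auto simp: fun_eq_iff)
  qed
  ultimately have "inj (\<lambda>i. prod_encode ` Sigma UNIV (q i))"
    by (metis (no_types, lifting) injD injI)
  then have "(UNIV :: ((nat \<Rightarrow> real) \<times> omega1 \<times> omega1) set) \<lesssim> (UNIV :: nat set set)"
    unfolding lepoll_def by blast
  also have "(UNIV :: nat set set) \<lesssim> (UNIV :: real set)"
    by (simp add: nat_sets_eqpoll_reals eqpoll_imp_lepoll)
  finally show ?thesis
    by (simp add: lepoll_iff_card_of)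
qed

section \<open>Assigning levels and target sets\<close>

text \<open>\<open>T x\<close> is the countable set that \<open>x\<close> is meant to be a limit of.\<close>
locale levelled_line =
  fixes lev :: "real \<Rightarrow> omega1" and T :: "real \<Rightarrow> real set"
  assumes many_limits: "\<And>S \<beta>. countable S \<Longrightarrow> uncountable (closure S) \<Longrightarrow>
    uncountable {x \<in> closure S - S. lev x = \<beta> \<and> T x = S}"

lemma levelled_line_exists:
  obtains lev T where "levelled_line lev T"
proof -
  \<comment> \<open>A task consists of an enumeration of the target, the wanted level and a label
    \<eta>. The label repeats each task omega_1 times, so that it is solved by uncountably many
    points.\<close>
  define I :: "((nat \<Rightarrow> real) \<times> omega1 \<times> omega1) set"
    where "I = {(\<sigma>, \<beta>, \<eta>). uncountable (closure (range \<sigma>))}"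
  define F where "F = (\<lambda>(\<sigma> :: nat \<Rightarrow> real, \<beta> :: omega1, \<eta> :: omega1). closure (range \<sigma>) - range \<sigma>)"
  have "|I| \<le>o |F i|" if "i \<in> I" for i
  proof -
    have "|I| \<le>o |UNIV :: real set|"
      using card_of_sequences_levels card_of_mono1[OF subset_UNIV] ordLeq_transitive by blast
    moreover have "(UNIV :: real set) \<lesssim> F i"
      using that uncountable_closed_lepoll[OF closed_closure] lepoll_Diff_countable uncountable_UNIV_real
      by (fastforce simp: I_def F_def)
    ultimately show ?thesis
      using lepoll_iff_card_of ordLeq_transitive by blast
  qed
  then obtain f where f: "inj_on f I" "\<And>i. i \<in> I \<Longrightarrow> f i \<in> F i"
    using inj_choice_of_large_sets by metis
  \<comment> \<open>As \<open>f\<close> is injective, a chosen point determines its task. Points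
    outside the range of \<open>f\<close> get unspecified values; this is harmless, since
    \<open>many_limits\<close> only asks for enough points and \<open>good\<close> will filter the
    targets.\<close>
  define lev where "lev x = fst (snd (inv_into I f x))" for x
  define T where "T x = range (fst (inv_into I f x))" for x
  have "uncountable {x \<in> closure S - S. lev x = \<beta> \<and> T x = S}"
    if "countable S" "uncountable (closure S)" for S \<beta>
  proof -
    have "S \<noteq> {}"
      using that by auto
    define \<sigma> where "\<sigma> = from_nat_into S"
    have \<sigma>: "range \<sigma> = S"
      unfolding \<sigma>_def using \<open>S \<noteq> {}\<close> that(1) by (rule range_from_nat_into)
    define h where "h \<eta> = f (\<sigma>, \<beta>, \<eta>)" for \<eta>
    have I: "(\<sigma>, \<beta>, \<eta>) \<in> I" for \<eta>
      unfolding I_def using that(2) \<sigma> by blast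
    have "inj h"
    proof (rule injI)
      fix \<eta> \<eta>' assume "h \<eta> = h \<eta>'"
      then show "\<eta> = \<eta>'"
        using inj_onD[OF f(1) _ I I] unfolding h_def by blast
    qed
    then have "uncountable (range h)"
      unfolding uncountable_iff_omega1_le by (intro card_of_ordLeqI) auto
    moreover have "range h \<subseteq> {x \<in> closure S - S. lev x = \<beta> \<and> T x = S}"
    proof clarify
      fix \<eta>
      have "inv_into I f (h \<eta>) = (\<sigma>, \<beta>, \<eta>)"
        unfolding h_def using f(1) I by (rule inv_into_f_f)
      then show "h \<eta> \<in> closure S - S \<and> lev (h \<eta>) = \<beta> \<and> T (h \<eta>) = S"
        using f(2)[OF I, of \<eta>] \<sigma> by (simp add: lev_def T_def F_def h_def)
    qed
    ultimately show ?thesis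
      using countable_subset by blast
  qed
  then have "levelled_line lev T"
    by unfold_locales
  then show ?thesis
    by (rule that)
qed

section \<open>The refined topology\<close>

context levelled_line
begin

text \<open>Selects the points that will be made limits of their targets; all others become
  isolated. Smaller levels make the recursion for \<open>V\<close> terminate, and injectivity leaves
  at most one point of the target on each level.\<close>

definition good :: "real \<Rightarrow> bool"
  where "good x \<longleftrightarrow> x \<in> closure (T x) \<and> inj_on lev (T x) \<and> (\<forall>y\<in>T x. lev y < lev x)"

definition approach :: "real \<Rightarrow> nat \<Rightarrow> real"
  where "approach x = (SOME s. (\<forall>k. s k \<in> T x) \<and> s \<longlonglongrightarrow> x)"

definition below :: "real \<Rightarrow> nat \<Rightarrow> omega1"
  where "below x = from_nat_into {..lev x}"

lemma approach:
  assumes "good x"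
  shows "approach x k \<in> T x" "approach x \<longlonglongrightarrow> x"
proof -
  have "\<exists>s. (\<forall>k. s k \<in> T x) \<and> s \<longlonglongrightarrow> x"
    using assms closure_sequential[of x "T x"] unfolding good_def by blast
  then have "(\<forall>k. approach x k \<in> T x) \<and> approach x \<longlonglongrightarrow> x"
    unfolding approach_def by (rule someI_ex)
  then show "approach x k \<in> T x" "approach x \<longlonglongrightarrow> x"
    by auto
qed

lemma lev_approach: "good x \<Longrightarrow> lev (approach x k) < lev x"
  using approach(1) unfolding good_def by blast

lemma below_surj:
  assumes "a \<le> lev x"
  obtains i where "below x i = a"
proof -
  have "\<exists>i. from_nat_into {..lev x} i = a"
    using assms countable_atMost_omega1 by (intro from_nat_into_surj) auto
  then show ?thesis
    using that unfolding below_def by blast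
qed

text \<open>The \<open>k\<close>-th neighbourhood used for \<open>x\<close> avoids the first \<open>k\<close> levels below \<open>x\<close> (in the
  enumeration \<open>below x\<close>) except at its centre; thus only finitely many of them contribute to any
  given level, besides their centres, which have distinct levels.\<close>
function V :: "real \<Rightarrow> nat \<Rightarrow> real set" where
  "V x n = insert x (if good x
     then \<Union>k\<in>{n..}. V (approach x k) (LEAST m.
       V (approach x k) m \<subseteq> ball (approach x k) (1 / Suc k) \<and>
       (\<forall>z\<in>V (approach x k) m. lev z \<in> below x ` {..k} \<longrightarrow> z = approach x k))
     else {})"
  by pat_completeness auto
termination
  \<comment> \<open>The guard \<open>good x\<close> puts \<open>approach x k\<close> on a strictly
    smaller level; the index may change freely.\<close>
  by (relation "inv_image {(a, b). a < b} (\<lambda>(x, n). lev x)")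
    (auto simp: lev_approach wf)

declare V.simps [simp del]

text \<open>Names the piece that \<open>V\<close> attaches around \<open>approach x k\<close>. That
  some index \<open>m\<close> meets the condition is not known yet; \<open>tame_avoid\<close>
  provides one when the centre is tame.\<close>

definition W :: "real \<Rightarrow> nat \<Rightarrow> real set"
  where "W x k = V (approach x k) (LEAST m.
    V (approach x k) m \<subseteq> ball (approach x k) (1 / Suc k) \<and>
    (\<forall>z\<in>V (approach x k) m. lev z \<in> below x ` {..k} \<longrightarrow> z = approach x k))"

lemma V_eq: "V x n = insert x (if good x then \<Union>k\<in>{n..}. W x k else {})"
  by (subst V.simps) (simp add: W_def)

lemma W_eq_V: "\<exists>m. W x k = V (approach x k) m"
  unfolding W_def by blast

lemma self_in_V: "x \<in> V x n"
  by (simp add: V_eq)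

lemma V_antimono: "m \<le> n \<Longrightarrow> V x n \<subseteq> V x m"
  by (auto simp: V_eq)

lemma W_subset_V: "good x \<Longrightarrow> n \<le> k \<Longrightarrow> W x k \<subseteq> V x n"
  by (auto simp: V_eq)

lemma approach_in_W: "approach x k \<in> W x k"
  using W_eq_V self_in_V by metis

text \<open>Well-founded induction on the level, in the form that matches the recursion of
  \<open>V\<close>.\<close>

lemma V_induct [case_names V]:
  assumes "\<And>x. (\<And>k. good x \<Longrightarrow> P (approach x k)) \<Longrightarrow> P x"
  shows "P x"
proof (induction x rule: measure_induct_rule[of lev])
  case (less x)
  show ?case
    using assms less lev_approach by blast
qed

lemma lev_V: "z \<in> V x n \<Longrightarrow> z = x \<or> lev z < lev x"
proof (induction x arbitrary: n rule: V_induct)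
  case (V x)
  show ?case
  proof (cases "z = x")
    case False
    then obtain k where k: "good x" "z \<in> W x k"
      using V.prems by (auto simp: V_eq split: if_splits)
    then have "z = approach x k \<or> lev z < lev (approach x k)"
      using V.IH W_eq_V by metis
    then show ?thesis
      using lev_approach[OF k(1), of k] by auto
  qed simp
qed

lemma countable_V: "countable (V x n)"
proof (induction x arbitrary: n rule: V_induct)
  case (V x)
  have "countable (W x k)" if "good x" for k
    using V[OF that] W_eq_V by metis
  then show ?case
    by (simp add: V_eq)
qed

section \<open>Small neighbourhoods with finite trace on every level\<close>

text \<open>The two conditions go through the induction together: finite traces and shrinking at the
  approach points allow the pieces \<open>W x k\<close> to avoid levels, and this avoidance gives
  finite traces at \<open>x\<close>.\<close>

definition tame :: "real \<Rightarrow> bool"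
  where "tame x \<longleftrightarrow> (\<forall>e>0. \<exists>n. V x n \<subseteq> ball x e) \<and> (\<forall>n a. finite {z \<in> V x n. lev z = a})"

text \<open>Only finitely many points of \<open>V y 0\<close> lie on the levels in \<open>A\<close>,
  so a small ball around \<open>y\<close> excludes all of them except possibly
  \<open>y\<close>.\<close>

lemma tame_avoid:
  assumes "tame y" "finite A" "e > 0"
  shows "\<exists>m. V y m \<subseteq> ball y e \<and> (\<forall>z\<in>V y m. lev z \<in> A \<longrightarrow> z = y)"
proof -
  have "{z \<in> V y 0. lev z \<in> A} = (\<Union>a\<in>A. {z \<in> V y 0. lev z = a})"
    by auto
  then have "finite {z \<in> V y 0. lev z \<in> A}"
    using assms(1,2) by (simp add: tame_def)
  then obtain d where d: "d > 0" "\<forall>z\<in>{z \<in> V y 0. lev z \<in> A}. z \<noteq> y \<longrightarrow> d \<le> dist y z"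
    using finite_set_avoid by blast
  have "min d e > 0"
    using d(1) assms(3) by simp
  then obtain m where m: "V y m \<subseteq> ball y (min d e)"
    using assms(1) unfolding tame_def by blast
  have "z = y" if "z \<in> V y m" "lev z \<in> A" for z
  proof (rule ccontr)
    assume "z \<noteq> y"
    then have "d \<le> dist y z"
      using d(2) that V_antimono[of 0 m y] by blast
    then show False
      using m that(1) by auto
  qed
  moreover have "V y m \<subseteq> ball y e"
    using m by auto
  ultimately show ?thesis
    by blast
qed

lemma W_tame:
  assumes "tame (approach x k)"
  shows "W x k \<subseteq> ball (approach x k) (1 / Suc k)"
    and "z \<in> W x k \<Longrightarrow> i \<le> k \<Longrightarrow> lev z = below x i \<Longrightarrow> z = approach x k"
proof -
  define P where "P m \<longleftrightarrow> V (approach x k) m \<subseteq> ball (approach x k) (1 / Suc k) \<and>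
    (\<forall>z\<in>V (approach x k) m. lev z \<in> below x ` {..k} \<longrightarrow> z = approach x k)" for m
  have "\<exists>m. P m"
    unfolding P_def using assms by (intro tame_avoid) auto
  then have "P (LEAST m. P m)"
    by (rule LeastI_ex)
  then have W: "W x k \<subseteq> ball (approach x k) (1 / Suc k) \<and>
      (\<forall>z\<in>W x k. lev z \<in> below x ` {..k} \<longrightarrow> z = approach x k)"
    unfolding P_def W_def .
  then show "W x k \<subseteq> ball (approach x k) (1 / Suc k)"
    by blast
  show "z = approach x k" if "z \<in> W x k" "i \<le> k" "lev z = below x i"
    using W that by auto
qed

lemma all_tame: "tame x"
proof (induction x rule: V_induct)
  case (V x)
  show ?case
  proof (cases "good x")
    case False
    then show ?thesis
      by (auto simp: tame_def V_eq)
  next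
    case True
    note W = W_tame[OF V[OF True]]
    have "\<exists>n. V x n \<subseteq> ball x e" if e: "e > 0" for e
    proof -
      have half: "e / 2 > 0"
        using e by simp
      obtain N where N: "\<And>k. k \<ge> N \<Longrightarrow> dist (approach x k) x < e / 2"
        using metric_LIMSEQ_D[OF approach(2)[OF True] half] by blast
      obtain M where M: "1 / real (Suc M) < e / 2"
        by (rule nat_approx_posE[OF half])
      have "W x k \<subseteq> ball x e" if "k \<ge> max N M" for k
      proof
        fix z assume "z \<in> W x k"
        then have "dist (approach x k) z < 1 / Suc k"
          using W(1) by (meson mem_ball subsetD)
        also have "\<dots> \<le> 1 / Suc M"
          using that by (intro frac_le) simp_all
        also note M
        finally have "dist (approach x k) z < e / 2" .
        moreover have "dist (approach x k) x < e / 2"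
          using N that by simp
        ultimately show "z \<in> ball x e"
          using dist_triangle_half_r[of "approach x k" x e z] by simp
      qed
      then have "(\<Union>k\<in>{max N M..}. W x k) \<subseteq> ball x e"
        by (intro UN_least) simp
      then have "V x (max N M) \<subseteq> ball x e"
        using e True by (simp add: V_eq)
      then show ?thesis
        by blast
    qed
    moreover have "finite {z \<in> V x n. lev z = a}" for n a
    proof (cases "a < lev x")
      case False
      then have "{z \<in> V x n. lev z = a} \<subseteq> {x}"
        using lev_V[of _ x n] by blast
      then show ?thesis
        by (rule finite_subset) simp
    next
      case a: True
      then obtain i where i: "below x i = a"
        by (rule below_surj[OF order_less_imp_le])
      \<comment> \<open>From index \<open>i\<close> on, the pieces avoid level
        \<open>a = below x i\<close> except at their centres, and the centres lie in
        \<open>T x\<close>, where levels are distinct.\<close>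
      have "{z \<in> V x n. lev z = a} \<subseteq> (\<Union>k<i. {z \<in> W x k. lev z = a}) \<union> {y \<in> T x. lev y = a}"
      proof
        fix z assume z: "z \<in> {z \<in> V x n. lev z = a}"
        then have "z \<noteq> x"
          using a by blast
        then obtain k where k: "z \<in> W x k"
          using z True by (auto simp: V_eq)
        show "z \<in> (\<Union>k<i. {z \<in> W x k. lev z = a}) \<union> {y \<in> T x. lev y = a}"
        proof (cases "k < i")
          case False
          then have "z = approach x k"
            using W(2)[OF k, of i] i z by simp
          then show ?thesis
            using approach(1)[OF True] z by auto
        qed (use k z in auto)
      qed
      moreover have "finite {z \<in> W x k. lev z = a}" for k
        using V[OF True, of k] W_eq_V[of x k] by (auto simp: tame_def)
      moreover have "finite {y \<in> T x. lev y = a}"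
      proof -
        have "inj_on lev {y \<in> T x. lev y = a}"
          using True by (auto simp: good_def intro: inj_on_subset)
        moreover have "finite (lev ` {y \<in> T x. lev y = a})"
          by (rule finite_subset[of _ "{a}"]) auto
        ultimately show ?thesis
          by (rule finite_imageD[rotated])
      qed
      ultimately show ?thesis
        by (elim finite_subset) simp
    qed
    ultimately show ?thesis
      by (simp add: tame_def)
  qed
qed

lemmas V_small = all_tame[unfolded tame_def, THEN conjunct1, rule_format]

section \<open>The topology and its local properties\<close>

definition X :: "real topology"
  where "X = topology (\<lambda>U. \<forall>x\<in>U. \<exists>n. V x n \<subseteq> U)"

lemma openin_X: "openin X U \<longleftrightarrow> (\<forall>x\<in>U. \<exists>n. V x n \<subseteq> U)"
proof -
  have "istopology (\<lambda>U. \<forall>x\<in>U. \<exists>n. V x n \<subseteq> U)"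
    unfolding istopology_def
  proof (intro conjI allI impI ballI)
    fix S U x assume SU: "\<forall>x\<in>S. \<exists>n. V x n \<subseteq> S" "\<forall>x\<in>U. \<exists>n. V x n \<subseteq> U" "x \<in> S \<inter> U"
    then obtain m n where "V x m \<subseteq> S" "V x n \<subseteq> U"
      by blast
    then have "V x (max m n) \<subseteq> S \<inter> U"
      using V_antimono[of m "max m n" x] V_antimono[of n "max m n" x] by auto
    then show "\<exists>n. V x n \<subseteq> S \<inter> U"
      by blast
  next
    fix \<K> x assume "\<forall>K\<in>\<K>. \<forall>x\<in>K. \<exists>n. V x n \<subseteq> K" "x \<in> \<Union>\<K>"
    then show "\<exists>n. V x n \<subseteq> \<Union>\<K>"
      by (meson UnionE Union_upper order_trans)
  qed
  then show ?thesis
    by (simp add: X_def topology_inverse')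
qed

lemma topspace_X [simp]: "topspace X = UNIV"
  using openin_subset[of X UNIV] by (auto simp: openin_X)

lemma openin_V: "openin X (V x n)"
proof (induction x arbitrary: n rule: V_induct)
  case (V x)
  show ?case
    unfolding openin_X
  proof
    fix z assume z: "z \<in> V x n"
    show "\<exists>m. V z m \<subseteq> V x n"
    proof (cases "z = x")
      case False
      then obtain k where k: "good x" "n \<le> k" "z \<in> W x k"
        using z by (auto simp: V_eq split: if_splits)
      then have "openin X (W x k)"
        using V W_eq_V by metis
      then obtain m where "V z m \<subseteq> W x k"
        using k(3) by (auto simp: openin_X)
      then show ?thesis
        using W_subset_V[OF k(1,2)] by blast
    qed blast
  qed
qed

text \<open>The sets \<open>V x n\<close> shrink into Euclidean balls, so the new topology refines
  the usual one and inherits its separation.\<close>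

lemma open_imp_openin_X: "open G \<Longrightarrow> openin X G"
  unfolding openin_X open_contains_ball using V_small by (meson order_trans)

lemma Hausdorff_X: "Hausdorff_space X"
  unfolding Hausdorff_space_def
proof (intro allI impI)
  fix x y assume "x \<in> topspace X \<and> y \<in> topspace X \<and> x \<noteq> y"
  then obtain U G where "open U" "open G" "x \<in> U" "y \<in> G" "U \<inter> G = {}"
    using hausdorff by metis
  then show "\<exists>U G. openin X U \<and> openin X G \<and> x \<in> U \<and> y \<in> G \<and> disjnt U G"
    using open_imp_openin_X by (metis disjnt_def)
qed

text \<open>A member of the cover that contains \<open>x\<close> swallows every piece
  \<open>W x k\<close> from some index \<open>m\<close> on. The finitely many earlier pieces are
  compact by induction.\<close>

lemma compactin_V: "compactin X (V x n)"
proof (induction x arbitrary: n rule: V_induct)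
  case (V x)
  have W: "compactin X (W x k)" if "good x" for k
    using V[OF that] W_eq_V by metis
  show ?case
    unfolding compactin_def
  proof (intro conjI allI impI)
    fix \<U> assume \<U>: "Ball \<U> (openin X) \<and> V x n \<subseteq> \<Union>\<U>"
    then obtain U where U: "U \<in> \<U>" "x \<in> U"
      using self_in_V by blast
    then obtain m where m: "V x m \<subseteq> U"
      using \<U> openin_X by blast
    show "\<exists>\<F>. finite \<F> \<and> \<F> \<subseteq> \<U> \<and> V x n \<subseteq> \<Union>\<F>"
    proof (cases "good x")
      case True
      have "compactin X (\<Union>k\<in>{n..<m}. W x k)"
        using W[OF True] by (intro compactin_Union) auto
      moreover have "(\<Union>k\<in>{n..<m}. W x k) \<subseteq> \<Union>\<U>"
        using \<U> W_subset_V[OF True] by (meson UN_least atLeastLessThan_iff order_trans)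
      ultimately obtain \<F> where \<F>: "finite \<F>" "\<F> \<subseteq> \<U>" "(\<Union>k\<in>{n..<m}. W x k) \<subseteq> \<Union>\<F>"
        using \<U> compactinD by metis
      have "V x n \<subseteq> V x m \<union> (\<Union>k\<in>{n..<m}. W x k)"
        using True by (force simp: V_eq)
      then have "V x n \<subseteq> \<Union>(insert U \<F>)"
        using m \<F>(3) by auto
      then show ?thesis
        using U(1) \<F>(1,2) by (intro exI[of _ "insert U \<F>"]) simp
    next
      case False
      then show ?thesis
        using U by (intro exI[of _ "{U}"]) (simp add: V_eq)
    qed
  qed simp
qed

lemma closedin_V: "closedin X (V x n)"
  using compactin_imp_closedin Hausdorff_X compactin_V by blast

lemma locally_countable_X: "locally_countable_space X"
  unfolding locally_countable_space_def nbhd_in_def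
  using openin_V countable_V self_in_V by (metis order_refl topspace_X top_greatest)

lemma locally_compact_X: "locally_compact_space X"
  unfolding locally_compact_space_def
  using openin_V compactin_V self_in_V by (metis order_refl)

lemma zero_dimensional_X: "zero_dimensional_space X"
proof -
  let ?B = "range (case_prod V)"
  have "openin X = arbitrary union_of (\<lambda>U. U \<in> ?B)"
    unfolding openin_topology_base_unique
  proof (intro conjI allI impI)
    fix U x assume "openin X U \<and> x \<in> U"
    then obtain n where "V x n \<subseteq> U"
      by (auto simp: openin_X)
    then show "\<exists>B. B \<in> ?B \<and> x \<in> B \<and> B \<subseteq> U"
      using self_in_V by (intro exI[of _ "V x n"]) auto
  qed (auto simp: openin_V)
  moreover have "\<forall>U\<in>?B. openin X U \<and> closedin X U"
    by (auto simp: openin_V closedin_V)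
  ultimately show ?thesis
    unfolding zero_dimensional_space_def by blast
qed

section \<open>Levels and closures\<close>

text \<open>By tameness every point has a neighbourhood without other points of level
  \<open>a\<close>, which gives closedness. For discreteness \<open>V x 0\<close> suffices, because
  its other points have smaller level than \<open>x\<close>.\<close>

lemma closed_discrete_level:
  assumes "\<And>x. x \<in> D \<Longrightarrow> lev x = a"
  shows "closed_discrete_in X D"
  unfolding closed_discrete_in_def
proof
  have "\<exists>n. V x n \<subseteq> - D" if "x \<notin> D" for x
  proof -
    obtain n where "\<forall>z\<in>V x n. lev z \<in> {a} \<longrightarrow> z = x"
      using tame_avoid[OF all_tame, of "{a}" 1 x] by auto
    then have "V x n \<subseteq> - D"
      using assms that by auto
    then show ?thesis ..
  qed
  then show "closedin X D"
    by (simp add: closedin_def openin_X Compl_eq_Diff_UNIV)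
  have "openin (subtopology X D) {x}" if "x \<in> D" for x
  proof -
    have "V x 0 \<inter> D = {x}"
    proof
      show "V x 0 \<inter> D \<subseteq> {x}"
      proof
        fix z assume "z \<in> V x 0 \<inter> D"
        then show "z \<in> {x}"
          using lev_V[of z x 0] assms[of z] assms[OF that] by auto
      qed
    qed (use that self_in_V in auto)
    then show ?thesis
      using openin_subtopology_Int[OF openin_V, of D x 0] by simp
  qed
  then have "discrete_topology D = subtopology X D"
    unfolding discrete_topology_unique by simp
  then show "subtopology X D = discrete_topology D"
    by simp
qed

lemma limit_in_closure:
  assumes "good x"
  shows "x \<in> X closure_of T x"
  unfolding in_closure_of
proof (intro conjI allI impI)
  fix U assume "x \<in> U \<and> openin X U"
  then obtain n where "V x n \<subseteq> U"
    by (auto simp: openin_X)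
  then show "\<exists>y. y \<in> T x \<and> y \<in> U"
    using approach(1)[OF assms] approach_in_W W_subset_V[OF assms order_refl] by blast
qed simp

text \<open>Keep one point of \<open>A\<close> on each level it meets and take a countable
  Euclidean-dense subset \<open>S\<close> of these points. Its Euclidean closure is uncountable, so
  \<open>many_limits\<close> yields uncountably many points with target \<open>S\<close>.\<close>

lemma uncountable_level_in_closure:
  assumes "uncountable (lev ` A)"
  obtains S \<beta> where "countable S" "S \<subseteq> A" "uncountable {x \<in> X closure_of S. lev x = \<beta>}"
proof -
  obtain A' where A': "A' \<subseteq> A" "inj_on lev A'" "lev ` A = lev ` A'"
    using subset_image_inj[THEN iffD1, OF order_refl[of "lev ` A"]] by blast
  obtain S where S: "countable S" "S \<subseteq> A'" "A' \<subseteq> closure S"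
    by (rule separable)
  have "uncountable A'"
    using assms countable_image[of A' lev] unfolding A'(3) by blast
  then have "uncountable (closure S)"
    using countable_subset[OF S(3)] by blast
  \<comment> \<open>Any level above all those of \<open>S\<close> will do: points of that level with
    target \<open>S\<close> are then good.\<close>
  obtain \<beta> where \<beta>: "\<forall>a\<in>lev ` S. a < \<beta>"
    by (rule countable_omega1_bounded[OF countable_image[OF S(1)]])
  have "inj_on lev S"
    using A'(2) S(2) by (rule inj_on_subset)
  have sub: "{x \<in> closure S - S. lev x = \<beta> \<and> T x = S} \<subseteq> {x \<in> X closure_of S. lev x = \<beta>}"
  proof
    fix x assume x: "x \<in> {x \<in> closure S - S. lev x = \<beta> \<and> T x = S}"
    then have "good x"
      using \<beta> \<open>inj_on lev S\<close> by (simp add: good_def)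
    then show "x \<in> {x \<in> X closure_of S. lev x = \<beta>}"
      using x limit_in_closure[of x] by simp
  qed
  have "uncountable {x \<in> closure S - S. lev x = \<beta> \<and> T x = S}"
    using S(1) \<open>uncountable (closure S)\<close> by (rule many_limits)
  then have "uncountable {x \<in> X closure_of S. lev x = \<beta>}"
    by (rule contrapos_nn) (rule countable_subset[OF sub])
  with S(1) subset_trans[OF S(2) A'(1)] show ?thesis
    by (rule that)
qed

text \<open>A countable dense set of reals has the whole line as closure, so it acquires limits on
  every level.\<close>

lemma lev_surj: "\<exists>x. lev x = \<beta>"
proof -
  obtain S :: "real set" where S: "countable S" "UNIV \<subseteq> closure S"
    by (rule separable)
  then have "uncountable (closure S)"
    using uncountable_UNIV_real countable_subset[OF S(2)] by blast
  with S(1) have "uncountable {x \<in> closure S - S. lev x = \<beta> \<and> T x = S}"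
    by (rule many_limits)
  then have "{x \<in> closure S - S. lev x = \<beta> \<and> T x = S} \<noteq> {}"
    using countable_empty by metis
  then show ?thesis
    by blast
qed

section \<open>Failure of linear D-ness, and the accumulation property\<close>

text \<open>The initial segments of levels form a chain of open sets. If those given by
  \<open>D\<close> cover the line, then \<open>D\<close> has unbounded, hence uncountably many,
  levels.\<close>

lemma not_linearly_D_X: "\<not> linearly_D_space X"
proof
  assume D: "linearly_D_space X"
  define U where "U x = {y. lev y \<le> lev x}" for x
  have "V y 0 \<subseteq> U x" if "y \<in> U x" for x y
    using lev_V that by (fastforce simp: U_def)
  then have "open_nbhd_assignment X U"
    unfolding open_nbhd_assignment_def openin_X by (auto simp: U_def)
  moreover have "chain\<^sub>\<subseteq> (U ` topspace X)"
  proof -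
    have "U x \<subseteq> U y \<or> U y \<subseteq> U x" for x y
      unfolding U_def using linear[of "lev x" "lev y"] by (auto intro: order_trans)
    then show ?thesis
      by (auto simp: chain_subset_def)
  qed
  ultimately obtain D where D: "closed_discrete_in X D" "UNIV = (\<Union>d\<in>D. U d)"
    using D by (auto simp: linearly_D_space_def)
  have "uncountable (lev ` D)"
  proof
    assume "countable (lev ` D)"
    then obtain \<beta> where \<beta>: "\<forall>a\<in>lev ` D. a < \<beta>"
      by (rule countable_omega1_bounded)
    obtain x where x: "lev x = \<beta>"
      using lev_surj by blast
    obtain d where "d \<in> D" "\<beta> \<le> lev d"
      using D(2) x by (auto simp: U_def)
    then show False
      using \<beta> by auto
  qed
  then obtain S \<beta> where S: "countable S" "S \<subseteq> D" "uncountable {x \<in> X closure_of S. lev x = \<beta>}"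
    by (rule uncountable_level_in_closure)
  \<comment> \<open>Subsets of a closed discrete set are closed, so the closure of \<open>S\<close>
    would be the countable set \<open>S\<close> itself.\<close>
  have "closedin X S"
  proof -
    have "closedin (subtopology X D) S"
      using D(1) S(2) by (simp add: closed_discrete_in_def)
    then show ?thesis
      using D(1) closedin_trans_full unfolding closed_discrete_in_def by blast
  qed
  then have "{x \<in> X closure_of S. lev x = \<beta>} \<subseteq> S"
    by (auto simp: closure_of_closedin)
  then show False
    using S(1,3) countable_subset by blast
qed

lemma accumulation_X: "complete_accumulation_or_closed_discrete X"
  unfolding complete_accumulation_or_closed_discrete_def
\<comment> \<open>The closed discrete alternative is established for every \<open>A\<close>.\<close>
proof (intro allI impI disjI2)
  fix \<kappa> :: "real rel" and A
  assume A: "Card_order \<kappa> \<and> regularCard \<kappa> \<and> uncountable (Field \<kappa>) \<and> A \<subseteq> topspace X \<and> |A| =o \<kappa>"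
  then have \<kappa>: "Card_order \<kappa>" "regularCard \<kappa>" "uncountable (Field \<kappa>)" and A\<kappa>: "|A| =o \<kappa>"
    by auto
  have inf: "Cinfinite \<kappa>"
    using \<kappa> countable_finite[of "Field \<kappa>"] unfolding cinfinite_def by blast
  have cl: "A \<subseteq> X closure_of A"
    by (simp add: closure_of_subset)
  show "\<exists>D \<subseteq> X closure_of A. |D| =o \<kappa> \<and> closed_discrete_in X D"
  proof (cases "\<exists>a. |{x \<in> A. lev x = a}| =o \<kappa>")
    case True
    then obtain a where "|{x \<in> A. lev x = a}| =o \<kappa>" ..
    moreover have "closed_discrete_in X {x \<in> A. lev x = a}"
      by (rule closed_discrete_level) simp
    moreover have "{x \<in> A. lev x = a} \<subseteq> X closure_of A"
      using cl by auto
    ultimately show ?thesis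
      by blast
  next
    case False
    have small: "|{x \<in> A. lev x = a}| <o \<kappa>" for a
    proof -
      have "|{x \<in> A. lev x = a}| \<le>o |A|"
        by (intro card_of_mono1) auto
      then have "|{x \<in> A. lev x = a}| \<le>o \<kappa>"
        using A\<kappa> by (rule ordLeq_ordIso_trans)
      with False show ?thesis
        unfolding ordLeq_iff_ordLess_or_ordIso by simp
    qed
    \<comment> \<open>Here regularity enters: fewer than \<kappa> levels, each with fewer than
      \<kappa> points of \<open>A\<close>, cannot make up \<open>A\<close>.\<close>
    have "\<not> |lev ` A| <o \<kappa>"
    proof
      assume "|lev ` A| <o \<kappa>"
      then have "|\<Union>a\<in>lev ` A. {x \<in> A. lev x = a}| <o \<kappa>"
        using \<kappa>(2) inf small by (intro card_of_UNION_ordLess_infinite_Field_regularCard) simp_all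
      moreover have "(\<Union>a\<in>lev ` A. {x \<in> A. lev x = a}) = A"
        by auto
      ultimately show False
        using A\<kappa> not_ordLess_ordIso by metis
    qed
    moreover have "Well_order \<kappa>"
      using \<kappa>(1) by (simp add: card_order_on_def)
    ultimately have "\<kappa> \<le>o |lev ` A|"
      using not_ordLess_iff_ordLeq[OF _ card_of_Well_order] by metis
    with A\<kappa> have le: "|A| \<le>o |lev ` A|"
      by (rule ordIso_ordLeq_trans)
    have "uncountable A"
    proof -
      have "|Field \<kappa>| =o |A|"
        using card_of_Field_ordIso[OF \<kappa>(1)] ordIso_symmetric[OF A\<kappa>] by (rule ordIso_transitive)
      then obtain g where "bij_betw g (Field \<kappa>) A"
        unfolding card_of_ordIso[symmetric] by (rule exE)
      then show ?thesis
        using \<kappa>(3) countableI_bij2 by metis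
    qed
    then have "|UNIV :: omega1 set| \<le>o |A|"
      unfolding uncountable_iff_omega1_le .
    then have "uncountable (lev ` A)"
      unfolding uncountable_iff_omega1_le using le by (rule ordLeq_transitive)
    then obtain S \<beta> where S: "countable S" "S \<subseteq> A" "uncountable {x \<in> X closure_of S. lev x = \<beta>}"
      by (rule uncountable_level_in_closure)
    let ?E = "{x \<in> X closure_of S. lev x = \<beta>}"
    \<comment> \<open>There are only omega_1 levels, so \<open>A\<close> has at most omega_1 points
      and embeds into the uncountable set \<open>?E\<close>, which lies on one level.\<close>
    have "|lev ` A| \<le>o |UNIV :: omega1 set|"
      by (rule card_of_mono1) simp
    with le have "|A| \<le>o |UNIV :: omega1 set|"
      by (rule ordLeq_transitive)
    then have "|A| \<le>o |?E|"
      using S(3)[unfolded uncountable_iff_omega1_le] by (rule ordLeq_transitive)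
    then obtain f where f: "inj_on f A" "f ` A \<subseteq> ?E"
      unfolding card_of_ordLeq[symmetric] by blast
    have "|f ` A| =o |A|"
      by (rule ordIso_symmetric[OF card_of_ordIsoI[OF inj_on_imp_bij_betw[OF f(1)]]])
    then have "|f ` A| =o \<kappa>"
      using A\<kappa> by (rule ordIso_transitive)
    moreover have "closed_discrete_in X (f ` A)"
      using f(2) by (intro closed_discrete_level[of _ \<beta>]) blast
    moreover have "f ` A \<subseteq> X closure_of A"
      using f(2) closure_of_mono[OF S(2), of X] by blast
    ultimately show ?thesis
      by blast
  qed
qed

end

theorem theorem4p10:
  shows "\<exists>X :: real topology.
    locally_countable_space X \<and> locally_compact_space X \<and>
    zero_dimensional_space X \<and> Hausdorff_space X \<and>
    \<not> linearly_D_space X \<and>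
    complete_accumulation_or_closed_discrete X"
proof -
  obtain lev T where "levelled_line lev T"
    by (rule levelled_line_exists)
  then interpret levelled_line lev T .
  show ?thesis
    using locally_countable_X locally_compact_X zero_dimensional_X Hausdorff_X
      not_linearly_D_X accumulation_X by blast
qed

end
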